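(* For any convex polytope $P$, the moment-angle complex $\mathcal{Z}_{K_P}$ is homotopy equivalent to the moment-angle space $\mathcal{Z}_P$: $$\mathcal{Z}_{K_P}\simeq \mathcal{Z}_P.$$
   Context: Let $P=\{x\in\mathbb{R}^n\mid \langle a_i,x\rangle+b_i\geqslant 0,\ i=1,\dots,m\}$ be a (bounded) $n$-dimensional convex polytope, not necessarily simple, whose facets are exactly the $m$ distinct sets $\mathcal{F}_i=\{x\in P\mid\langle a_i,x\rangle+b_i=0\}$, $i=1,\dots,m$. Write $[m]=\{1,\dots,m\}$. The simplicial complex $K_P$ has vertex set $[m]$; a subset $\{i_1,\dots,i_k\}\subseteq[m]$ is a simplex of $K_P$ iff $\mathcal{F}_{i_1}\cap\dots\cap\mathcal{F}_{i_k}\neq\varnothing$ (the empty set is also a simplex). Moment-angle space of $P$: let $\mathbb{R}^m_{\geqslant}$ be the nonnegative orthant, let $j_P\colon P\to\mathbb{R}^m_{\geqslant}$, $j_P(x)=(\langle a_1,x\rangle+b_1,\dots,\langle a_m,x\rangle+b_m)$, and $p\colon\mathbb{C}^m\to\mathbb{R}^m_{\geqslant}$, $p(z_1,\dots,z_m)=(|z_1|^2,\dots,|z_m|^2)$. Then $\mathcal{Z}_P$ is the pullback of $j_P$ and $p$, i.e. $\mathcal{Z}_P\cong p^{-1}(j_P(P))\subset\mathbb{C}^m$. Moment-angle complex of a simplicial complex $K\subseteq 2^{[m]}$: with $D^2\subset\mathbb{C}$ the closed unit disk and $S^1=\partial D^2$, $$\mathcal{Z}_K=(D^2,S^1)^K=\bigcup_{\alpha\in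 K}(D^2)^{\alpha}\times (S^1)^{[m]\setminus\alpha}\subseteq (D^2)^m,$$ where $(D^2)^{\alpha}\times (S^1)^{[m]\setminus\alpha}$ is the set of $(z_1,\dots,z_m)$ with $z_i\in D^2$ for $i\in\alpha$ and $z_i\in S^1$ for $i\notin\alpha$. *)

theory Defs
  imports "HOL-Analysis.Analysis"
begin

definition H_polyhedron :: "('m \<Rightarrow> real ^ 'n) \<Rightarrow> ('m \<Rightarrow> real) \<Rightarrow> (real ^ 'n) set"
  where "H_polyhedron a b = {x. \<forall>i. a i \<bullet> x + b i \<ge> 0}"

definition H_facet :: "('m \<Rightarrow> real ^ 'n) \<Rightarrow> ('m \<Rightarrow> real) \<Rightarrow> 'm \<Rightarrow> (real ^ 'n) set"
  where "H_facet a b i = {x \<in> H_polyhedron a b. a i \<bullet> x + b i = 0}"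

(* The empty set is a simplex: the intersection over the empty index set is UNIV. *)
definition facet_complex :: "('m \<Rightarrow> real ^ 'n) \<Rightarrow> ('m \<Rightarrow> real) \<Rightarrow> 'm set set"
  where "facet_complex a b = {\<alpha>. (\<Inter>i\<in>\<alpha>. H_facet a b i) \<noteq> {}}"

definition polytope_embedding ::
    "('m::finite \<Rightarrow> real ^ 'n) \<Rightarrow> ('m \<Rightarrow> real) \<Rightarrow> real ^ 'n \<Rightarrow> real ^ 'm"
  where "polytope_embedding a b x = (\<chi> i. a i \<bullet> x + b i)"

definition moment_map :: "complex ^ 'm \<Rightarrow> real ^ 'm"
  where "moment_map z = (\<chi> i. (cmod (z $ i))\<^sup>2)"

(* The pullback of polytope_embedding, restricted to the polytope, along moment_map,
   taken as a subspace of the product. Both maps have values in the nonnegative orthant,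
   so it makes no difference that the orthant is not carved out of the codomain. *)
definition moment_angle_space ::
    "('m::finite \<Rightarrow> real ^ 'n) \<Rightarrow> ('m \<Rightarrow> real) \<Rightarrow> ((real ^ 'n) \<times> (complex ^ 'm)) set"
  where "moment_angle_space a b =
           {(x, z). x \<in> H_polyhedron a b \<and> polytope_embedding a b x = moment_map z}"

definition moment_angle_complex :: "'m set set \<Rightarrow> (complex ^ 'm) set"
  where "moment_angle_complex K =
           (\<Union>\<alpha>\<in>K. {z. (\<forall>i\<in>\<alpha>. z $ i \<in> cball 0 1) \<and> (\<forall>i\<in>-\<alpha>. z $ i \<in> sphere 0 1)})"

end

theory Submission
  imports Defs
begin

text \<open>
  Write \<open>f\<^sub>i(x) = a\<^sub>i \<bullet> x + b\<^sub>i\<close>.  Two auxiliary spaces interpolate between the complex and the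
  moment-angle space: the complement \<open>U\<close> of a coordinate subspace arrangement, consisting of all
  \<open>z\<close> whose zero set is a simplex, and the space \<open>L\<close> of all \<open>(x, z)\<close> with \<open>x \<in> P\<close> and
  \<open>f\<^sub>i(x) = 0\<close> whenever \<open>z\<^sub>i = 0\<close>.  Dividing \<open>z\<^sub>i\<close> by \<open>max \<bar>z\<^sub>i\<bar> \<delta>(z)\<close> for a suitable threshold
  \<open>\<delta> > 0\<close> deforms \<open>U\<close> into the complex.  The fibres of \<open>L \<rightarrow> U\<close> are faces of \<open>P\<close>, hence convex,
  and a section is obtained by choosing a point on every face and averaging these points with
  weights that vanish unless the zero set of \<open>z\<close> is contained in the simplex of the face.
  Finally, changing the moduli \<open>\<bar>z\<^sub>i\<bar>\<close> to the square roots of \<open>f\<^sub>i(x)\<close> retracts \<open>L\<close> to the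
  moment-angle space.  All homotopies involved are linear.
\<close>

text \<open>Reduces each of the three equivalences below to two containments of segments, along
  which the composites are joined to the identities.\<close>

lemma homotopy_eqv_linear:
  fixes f :: "'a::real_normed_vector \<Rightarrow> 'b::real_normed_vector"
  assumes f: "continuous_on S f" "f \<in> S \<rightarrow> T" and g: "continuous_on T g" "g \<in> T \<rightarrow> S"
    and S: "\<And>x. x \<in> S \<Longrightarrow> closed_segment (g (f x)) x \<subseteq> S"
    and T: "\<And>y. y \<in> T \<Longrightarrow> closed_segment (f (g y)) y \<subseteq> T"
  shows "S homotopy_eqv T"
proof -
  have "continuous_on S (g \<circ> f)" "continuous_on T (f \<circ> g)"
    using f g by (auto simp: comp_def intro: continuous_on_compose2)
  then have "homotopic_with_canon (\<lambda>x. True) S S (g \<circ> f) id"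
    and "homotopic_with_canon (\<lambda>x. True) T T (f \<circ> g) id"
    using S T by (simp_all add: homotopic_with_linear continuous_on_id)
  then show ?thesis
    unfolding homotopy_equivalent_space_def using f g
    by (intro exI[of _ f] exI[of _ g]) auto
qed

lemma in_segmentE:
  assumes "y \<in> closed_segment (x :: 'a::real_vector) x'"
  obtains u where "0 \<le> u" "u \<le> 1" "y = (1 - u) *\<^sub>R x + u *\<^sub>R x'"
  using assms by (auto simp: closed_segment_def)

section \<open>Simplicial complexes and coordinate subspace arrangements\<close>

definition abstract_simplicial_complex :: "'m set set \<Rightarrow> bool"
  where "abstract_simplicial_complex K \<longleftrightarrow> {} \<in> K \<and> (\<forall>\<alpha>\<in>K. \<forall>\<beta>\<subseteq>\<alpha>. \<beta> \<in> K)"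

lemma abstract_simplicial_complex_subset:
  "abstract_simplicial_complex K \<Longrightarrow> \<alpha> \<in> K \<Longrightarrow> \<beta> \<subseteq> \<alpha> \<Longrightarrow> \<beta> \<in> K"
  by (auto simp: abstract_simplicial_complex_def)

definition arrangement_complement :: "'m set set \<Rightarrow> (complex ^ 'm) set"
  where "arrangement_complement K = {z. {i. z $ i = 0} \<in> K}"

text \<open>Every simplex witnessing membership contains the indices of modulus below 1; by closure
  under subsets these form the smallest witness.\<close>

lemma moment_angle_complex_iff:
  assumes "abstract_simplicial_complex K"
  shows "z \<in> moment_angle_complex K \<longleftrightarrow> (\<forall>i. cmod (z $ i) \<le> 1) \<and> {i. cmod (z $ i) < 1} \<in> K"
    (is "?L \<longleftrightarrow> ?R")
proof
  assume ?L
  then obtain \<alpha> where \<alpha>: "\<alpha> \<in> K" "\<forall>i\<in>\<alpha>. cmod (z $ i) \<le> 1" "\<forall>i\<in>-\<alpha>. cmod (z $ i) = 1"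
    by (auto simp: moment_angle_complex_def)
  then have "{i. cmod (z $ i) < 1} \<subseteq> \<alpha>"
    by force
  moreover have "cmod (z $ i) \<le> 1" for i
    using \<alpha> by (cases "i \<in> \<alpha>") auto
  ultimately show ?R
    using assms \<alpha> abstract_simplicial_complex_subset by blast
next
  assume ?R
  then show ?L
    unfolding moment_angle_complex_def
    by (auto intro!: bexI[of _ "{i. cmod (z $ i) < 1}"] simp: less_le)
qed

lemma moment_angle_complex_subset:
  assumes "abstract_simplicial_complex K"
  shows "moment_angle_complex K \<subseteq> arrangement_complement K"
proof
  fix z assume "z \<in> moment_angle_complex K"
  then have "{i. cmod (z $ i) < 1} \<in> K"
    by (simp add: moment_angle_complex_iff[OF assms])
  moreover have "{i. z $ i = 0} \<subseteq> {i. cmod (z $ i) < 1}"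
    by auto
  ultimately show "z \<in> arrangement_complement K"
    using assms abstract_simplicial_complex_subset by (auto simp: arrangement_complement_def)
qed

section \<open>Deformation of the arrangement complement\<close>

text \<open>Continuous in \<open>z\<close>, and nonzero exactly when the zero set of
  \<open>z\<close> lies in \<alpha>. Capping the factors at 1 bounds the product by each of
  them.\<close>

definition simplex_weight :: "'m::finite set \<Rightarrow> complex ^ 'm \<Rightarrow> real"
  where "simplex_weight \<alpha> z = (\<Prod>i\<in>-\<alpha>. min 1 (cmod (z $ i)))"

lemma continuous_on_simplex_weight [continuous_intros]: "continuous_on S (simplex_weight \<alpha>)"
  unfolding simplex_weight_def by (intro continuous_intros)

lemma simplex_weight_nonneg: "0 \<le> simplex_weight \<alpha> z"
  unfolding simplex_weight_def by (intro prod_nonneg) auto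

lemma simplex_weight_le_1: "simplex_weight \<alpha> z \<le> 1"
  unfolding simplex_weight_def by (intro prod_le_1) auto

lemma simplex_weight_eq_0: "i \<notin> \<alpha> \<Longrightarrow> z $ i = 0 \<Longrightarrow> simplex_weight \<alpha> z = 0"
  unfolding simplex_weight_def by force

lemma simplex_weight_zeros_pos: "0 < simplex_weight {i. z $ i = 0} z"
  unfolding simplex_weight_def by (intro prod_pos) auto

lemma simplex_weight_le_cmod:
  assumes "i \<notin> \<alpha>"
  shows "simplex_weight \<alpha> z \<le> cmod (z $ i)"
proof -
  have "simplex_weight \<alpha> z
      = min 1 (cmod (z $ i)) * (\<Prod>j\<in>-\<alpha> - {i}. min 1 (cmod (z $ j)))"
    unfolding simplex_weight_def using assms by (intro prod.remove) auto
  also have "\<dots> \<le> min 1 (cmod (z $ i)) * 1"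
    by (intro mult_left_mono prod_le_1) auto
  finally show ?thesis by simp
qed

text \<open>The zero set of \<open>z\<close> is itself a simplex, and its own weight is
  positive.\<close>

lemma sum_simplex_weight_pos:
  fixes z :: "complex ^ 'm::finite"
  assumes "z \<in> arrangement_complement K"
  shows "0 < (\<Sum>\<alpha>\<in>K. simplex_weight \<alpha> z)"
  using assms simplex_weight_zeros_pos[of z]
  by (intro sum_pos2[where i = "{i. z $ i = 0}"])
    (auto simp: arrangement_complement_def simplex_weight_nonneg)

definition threshold :: "'m::finite set set \<Rightarrow> complex ^ 'm \<Rightarrow> real"
  where "threshold K z = (\<Sum>\<alpha>\<in>K. simplex_weight \<alpha> z) / card K"

lemma continuous_on_threshold [continuous_intros]:
  "abstract_simplicial_complex K \<Longrightarrow> continuous_on S (threshold (K :: 'm::finite set set))"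
  unfolding threshold_def abstract_simplicial_complex_def by (intro continuous_intros) auto

lemma threshold_pos:
  fixes z :: "complex ^ 'm::finite"
  assumes "z \<in> arrangement_complement K"
  shows "0 < threshold K z"
proof -
  have "K \<noteq> {}" using assms by (auto simp: arrangement_complement_def)
  then show ?thesis
    using sum_simplex_weight_pos[OF assms] by (simp add: threshold_def card_gt_0_iff)
qed

lemma threshold_le_1:
  fixes K :: "'m::finite set set"
  assumes "abstract_simplicial_complex K"
  shows "threshold K z \<le> 1"
proof -
  have "K \<noteq> {}" using assms by (auto simp: abstract_simplicial_complex_def)
  then show ?thesis
    using sum_bounded_above[of K "\<lambda>\<alpha>. simplex_weight \<alpha> z" 1]
    by (simp add: threshold_def simplex_weight_le_1 card_gt_0_iff)
qed

text \<open>Some weight is at least the average weight \<open>threshold K z\<close>.\<close>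
lemma below_threshold_simplex:
  fixes K :: "'m::finite set set"
  assumes "abstract_simplicial_complex K"
  shows "{i. cmod (z $ i) < threshold K z} \<in> K"
proof -
  have K: "K \<noteq> {}" using assms by (auto simp: abstract_simplicial_complex_def)
  have "\<exists>\<alpha>\<in>K. threshold K z \<le> simplex_weight \<alpha> z"
  proof (rule ccontr)
    assume "\<not> ?thesis"
    then have "(\<Sum>\<alpha>\<in>K. simplex_weight \<alpha> z) < (\<Sum>\<alpha>\<in>K. threshold K z)"
      using K by (intro sum_strict_mono) auto
    then show False using K by (simp add: threshold_def)
  qed
  then obtain \<alpha> where \<alpha>: "\<alpha> \<in> K" "threshold K z \<le> simplex_weight \<alpha> z" by blast
  then have "{i. cmod (z $ i) < threshold K z} \<subseteq> \<alpha>"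
    using simplex_weight_le_cmod[of _ \<alpha> z] by force
  then show ?thesis
    using assms \<alpha> abstract_simplicial_complex_subset by blast
qed

lemma moment_angle_complex_eqv_arrangement_complement:
  fixes K :: "'m::finite set set"
  assumes K: "abstract_simplicial_complex K"
  shows "moment_angle_complex K homotopy_eqv arrangement_complement K"
proof -
  let ?Z = "moment_angle_complex K" and ?U = "arrangement_complement K"
  define r :: "complex ^ 'm \<Rightarrow> complex ^ 'm"
    where "r z = (\<chi> i. z $ i /\<^sub>R max (cmod (z $ i)) (threshold K z))" for z
  have ZU: "?Z \<subseteq> ?U" by (rule moment_angle_complex_subset[OF K])
  have contr: "continuous_on ?U r"
    unfolding r_def using K
    by (intro continuous_intros) (auto dest: threshold_pos simp: max_def split: if_splits)
  have norm_r: "cmod (r z $ i) = cmod (z $ i) / max (cmod (z $ i)) (threshold K z)"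
    if "z \<in> ?U" for z i
    using threshold_pos[OF that] by (simp add: r_def divide_inverse_commute abs_if)
  have rZ: "r z \<in> ?Z" if "z \<in> ?U" for z
  proof -
    have "cmod (r z $ i) \<le> 1" for i
      using threshold_pos[OF that] by (auto simp: norm_r[OF that] divide_le_eq_1 max_def)
    moreover have "{i. cmod (r z $ i) < 1} = {i. cmod (z $ i) < threshold K z}"
      using threshold_pos[OF that] by (auto simp: norm_r[OF that] divide_less_eq_1 max_def)
    ultimately show ?thesis
      using below_threshold_simplex[OF K] by (simp add: moment_angle_complex_iff[OF K])
  qed
  have segU: "closed_segment (r z) z \<subseteq> ?U" if z: "z \<in> ?U" for z
  proof
    fix y assume "y \<in> closed_segment (r z) z"
    then obtain u where u: "0 \<le> u" "u \<le> 1" and y: "y = (1 - u) *\<^sub>R r z + u *\<^sub>R z"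
      by (rule in_segmentE)
    \<comment> \<open>In each coordinate \<open>r z\<close> is a positive multiple of
      \<open>z\<close>, so the zero set is constant along the segment.\<close>
    have "y $ i = 0 \<longleftrightarrow> z $ i = 0" for i
    proof -
      let ?M = "max (cmod (z $ i)) (threshold K z)"
      have "0 < ?M" using threshold_pos[OF z] by simp
      then have "0 < (1 - u) / ?M + u"
        using u by (cases "u = 1") (auto intro!: add_pos_nonneg)
      moreover have "y $ i = ((1 - u) / ?M + u) *\<^sub>R z $ i"
        by (simp add: y r_def scaleR_left.add divide_inverse)
      ultimately show ?thesis by (simp only: scaleR_eq_0_iff) simp
    qed
    then show "y \<in> ?U" using z by (simp add: arrangement_complement_def)
  qed
  have segZ: "closed_segment (r z) z \<subseteq> ?Z" if z: "z \<in> ?Z" for z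
  proof
    fix y assume "y \<in> closed_segment (r z) z"
    then obtain u where u: "0 \<le> u" "u \<le> 1" and y: "y = (1 - u) *\<^sub>R r z + u *\<^sub>R z"
      by (rule in_segmentE)
    have "r z \<in> ?Z" using z ZU rZ by blast
    then have le: "cmod (r z $ i) \<le> 1" "cmod (z $ i) \<le> 1" for i
      using z by (auto simp: moment_angle_complex_iff[OF K])
    have "cmod (y $ i) \<le> 1" for i
    proof -
      have "cmod (y $ i) \<le> (1 - u) * cmod (r z $ i) + u * cmod (z $ i)"
        using u norm_triangle_ineq[of "(1 - u) *\<^sub>R r z $ i" "u *\<^sub>R z $ i"] by (simp add: y)
      also have "\<dots> \<le> 1" using le u by (intro convex_bound_le) auto
      finally show ?thesis .
    qed
    \<comment> \<open>As the threshold is at most 1, \<open>r\<close> fixes coordinates of modulus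
      1; hence no new index of modulus below 1 appears on the segment.\<close>
    moreover have "cmod (y $ i) = 1" if "cmod (z $ i) = 1" for i
    proof -
      have "y $ i = z $ i"
        using that threshold_le_1[OF K, of z]
        by (simp add: y r_def max_absorb1 flip: scaleR_left.add)
      with that show ?thesis by simp
    qed
    then have "{i. cmod (y $ i) < 1} \<subseteq> {i. cmod (z $ i) < 1}"
      using le(2) by (auto simp: less_le)
    ultimately show "y \<in> ?Z"
      using z abstract_simplicial_complex_subset[OF K] unfolding moment_angle_complex_iff[OF K]
      by blast
  qed
  show ?thesis
    by (rule homotopy_eqv_linear[where f = id and g = r])
      (use ZU contr rZ segU segZ in \<open>auto simp: continuous_on_id\<close>)
qed

section \<open>Faces of the polytope over the arrangement complement\<close>

text \<open>Weakens the equation \<open>a i \<bullet> x + b i = (cmod (z $ i))\<^sup>2\<close> of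
  the moment-angle space to its consequence at the zeros of \<open>z\<close>.\<close>

definition facet_incidence_space ::
    "('m::finite \<Rightarrow> real ^ 'n) \<Rightarrow> ('m \<Rightarrow> real) \<Rightarrow> ((real ^ 'n) \<times> (complex ^ 'm)) set"
  where "facet_incidence_space a b =
           {(x, z). x \<in> H_polyhedron a b \<and> (\<forall>i. z $ i = 0 \<longrightarrow> a i \<bullet> x + b i = 0)}"

text \<open>Nonemptiness settles the case of the empty simplex, where the intersection is
  \<open>UNIV\<close> and says nothing about the polytope.\<close>

lemma facet_complex_iff:
  assumes "H_polyhedron a b \<noteq> {}"
  shows "\<alpha> \<in> facet_complex a b \<longleftrightarrow> (\<exists>x\<in>H_polyhedron a b. \<forall>i\<in>\<alpha>. a i \<bullet> x + b i = 0)"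
  using assms by (cases "\<alpha> = {}") (auto simp: facet_complex_def H_facet_def)

lemma abstract_simplicial_complex_facet_complex:
  assumes "H_polyhedron a b \<noteq> {}"
  shows "abstract_simplicial_complex (facet_complex a b)"
  using assms by (auto simp: abstract_simplicial_complex_def facet_complex_iff[OF assms]) blast+

lemma convex_affine_ge_0:
  fixes x y :: "'a::real_inner"
  assumes "0 \<le> a \<bullet> x + b" "0 \<le> a \<bullet> y + b" "0 \<le> u" "u \<le> 1"
  shows "0 \<le> a \<bullet> ((1 - u) *\<^sub>R x + u *\<^sub>R y) + b"
proof -
  have "a \<bullet> ((1 - u) *\<^sub>R x + u *\<^sub>R y) + b = (1 - u) * (a \<bullet> x + b) + u * (a \<bullet> y + b)"
    by (simp add: inner_simps algebra_simps)
  with assms show ?thesis by simp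
qed

lemma convex_affine_eq_0:
  fixes x y :: "'a::real_inner"
  assumes "a \<bullet> x + b = 0" "a \<bullet> y + b = 0"
  shows "a \<bullet> ((1 - u) *\<^sub>R x + u *\<^sub>R y) + b = 0"
proof -
  have "a \<bullet> ((1 - u) *\<^sub>R x + u *\<^sub>R y) + b = (1 - u) * (a \<bullet> x + b) + u * (a \<bullet> y + b)"
    by (simp add: inner_simps algebra_simps)
  with assms show ?thesis by simp
qed

lemma arrangement_complement_section:
  fixes a :: "'m::finite \<Rightarrow> real ^ 'n"
  assumes P: "H_polyhedron a b \<noteq> {}"
  defines "U \<equiv> arrangement_complement (facet_complex a b)"
  obtains G where "continuous_on U G" "\<And>z. z \<in> U \<Longrightarrow> (G z, z) \<in> facet_incidence_space a b"
proof -
  let ?K = "facet_complex a b"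
  have "\<forall>\<alpha>\<in>?K. \<exists>x. x \<in> H_polyhedron a b \<and> (\<forall>i\<in>\<alpha>. a i \<bullet> x + b i = 0)"
    using facet_complex_iff[OF P] by blast
  then obtain v where v: "\<And>\<alpha>. \<alpha> \<in> ?K \<Longrightarrow> v \<alpha> \<in> H_polyhedron a b"
      "\<And>\<alpha> i. \<alpha> \<in> ?K \<Longrightarrow> i \<in> \<alpha> \<Longrightarrow> a i \<bullet> v \<alpha> + b i = 0"
    by metis
  define W where "W z = (\<Sum>\<alpha>\<in>?K. simplex_weight \<alpha> z)" for z :: "complex ^ 'm"
  define G where "G z = (\<Sum>\<alpha>\<in>?K. simplex_weight \<alpha> z *\<^sub>R v \<alpha>) /\<^sub>R W z" for z
  have W: "0 < W z" if "z \<in> U" for z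
    using sum_simplex_weight_pos that unfolding W_def U_def by blast
  \<comment> \<open>The normalized weights sum to 1, so affine functions commute with the
    averaging.\<close>
  have affG: "a i \<bullet> G z + b i = (\<Sum>\<alpha>\<in>?K. simplex_weight \<alpha> z * (a i \<bullet> v \<alpha> + b i)) / W z"
    if "z \<in> U" for z i
  proof -
    have "(\<Sum>\<alpha>\<in>?K. simplex_weight \<alpha> z * (a i \<bullet> v \<alpha> + b i))
        = (\<Sum>\<alpha>\<in>?K. simplex_weight \<alpha> z * (a i \<bullet> v \<alpha>)) + W z * b i"
      by (simp add: W_def sum.distrib sum_distrib_right distrib_left)
    then show ?thesis
      using W[OF that] by (simp add: G_def inner_sum_right field_simps)
  qed
  show ?thesis
  proof
    show "continuous_on U G"
      unfolding G_def using W unfolding W_def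
      by (intro continuous_intros) force
    fix z assume z: "z \<in> U"
    have "0 \<le> a i \<bullet> G z + b i" for i
      unfolding affG[OF z] using W[OF z] v(1)
      by (auto intro!: divide_nonneg_pos sum_nonneg mult_nonneg_nonneg simplex_weight_nonneg
          simp: H_polyhedron_def)
    moreover have "a i \<bullet> G z + b i = 0" if "z $ i = 0" for i
    proof -
      \<comment> \<open>Either \<open>i\<close> lies in \<alpha> and \<open>v \<alpha>\<close> is on
        facet \<open>i\<close>, or the weight has the factor \<open>cmod (z $ i)\<close>, capped at
        1, which is 0.\<close>
      have "simplex_weight \<alpha> z * (a i \<bullet> v \<alpha> + b i) = 0" if "\<alpha> \<in> ?K" for \<alpha>
        using v(2)[OF that, of i] simplex_weight_eq_0[of i \<alpha> z] \<open>z $ i = 0\<close> by fastforce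
      then show ?thesis unfolding affG[OF z] by (simp add: sum.neutral)
    qed
    ultimately show "(G z, z) \<in> facet_incidence_space a b"
      by (simp add: facet_incidence_space_def H_polyhedron_def)
  qed
qed

text \<open>The section and \<open>snd\<close> are inverse up to homotopy: one composite is the
  identity, the other moves only \<open>x\<close>, within a convex fibre.\<close>

lemma arrangement_complement_eqv_facet_incidence_space:
  fixes a :: "'m::finite \<Rightarrow> real ^ 'n"
  assumes P: "H_polyhedron a b \<noteq> {}"
  shows "arrangement_complement (facet_complex a b) homotopy_eqv facet_incidence_space a b"
proof -
  let ?U = "arrangement_complement (facet_complex a b)" and ?L = "facet_incidence_space a b"
  obtain G where contG: "continuous_on ?U G" and G: "\<And>z. z \<in> ?U \<Longrightarrow> (G z, z) \<in> ?L"
    using arrangement_complement_section[OF P] by blast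
  have LU: "z \<in> ?U" if "(x, z) \<in> ?L" for x z
    using that by (auto simp: facet_incidence_space_def arrangement_complement_def
        facet_complex_iff[OF P])
  have segL: "y \<in> ?L"
    if xz: "(x, z) \<in> ?L" and y: "y \<in> closed_segment (G z, z) (x, z)" for x z y
  proof -
    from y obtain u where u: "0 \<le> u" "u \<le> 1"
      and y_eq: "y = (1 - u) *\<^sub>R (G z, z) + u *\<^sub>R (x, z)"
      by (rule in_segmentE)
    have "y = ((1 - u) *\<^sub>R G z + u *\<^sub>R x, z)"
      unfolding y_eq by (simp flip: scaleR_left.add)
    then show "y \<in> ?L"
      using u xz G[OF LU[OF xz]]
      by (auto simp: facet_incidence_space_def H_polyhedron_def
          intro!: convex_affine_ge_0 convex_affine_eq_0)
  qed
  show ?thesis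
    by (rule homotopy_eqv_linear[where f = "\<lambda>z. (G z, z)" and g = snd])
      (use contG G LU segL in \<open>auto intro!: continuous_intros\<close>)
qed

section \<open>Retraction to the moment-angle space\<close>

text \<open>The hypothesis on the zeros of \<open>u\<close> compensates for the discontinuity of \<open>sgn\<close> at 0.\<close>
lemma continuous_on_sgn_scaleR:
  fixes u :: "'a::topological_space \<Rightarrow> 'b::real_normed_vector" and h :: "'a \<Rightarrow> real"
  assumes u: "continuous_on S u" and h: "continuous_on S h"
    and 0: "\<And>x. x \<in> S \<Longrightarrow> u x = 0 \<Longrightarrow> h x = 0"
  shows "continuous_on S (\<lambda>x. h x *\<^sub>R sgn (u x))"
  unfolding continuous_on_def
proof
  fix x assume x: "x \<in> S"
  have lim: "(u \<longlongrightarrow> u x) (at x within S)" "(h \<longlongrightarrow> h x) (at x within S)"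
    using u h x by (auto simp: continuous_on_def)
  show "((\<lambda>x. h x *\<^sub>R sgn (u x)) \<longlongrightarrow> h x *\<^sub>R sgn (u x)) (at x within S)"
  proof (cases "u x = 0")
    case False
    then show ?thesis using lim by (intro tendsto_intros)
  next
    case True
    \<comment> \<open>At a zero of \<open>u\<close> the bounded factor \<open>sgn\<close> is
      absorbed by \<open>h\<close>, which tends to 0.\<close>
    then have "(h \<longlongrightarrow> 0) (at x within S)" using lim(2) 0[OF x] by simp
    then have "((\<lambda>x. \<bar>h x\<bar>) \<longlongrightarrow> 0) (at x within S)"
      by (simp add: tendsto_rabs_zero)
    then have "((\<lambda>x. h x *\<^sub>R sgn (u x)) \<longlongrightarrow> 0) (at x within S)"
      by (rule Lim_null_comparison[rotated]) (auto simp: norm_sgn)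
    then show ?thesis using True by simp
  qed
qed

text \<open>The map \<open>f\<close> keeps \<open>x\<close> and the phases of \<open>z\<close>,
  corrects the moduli, and fixes the moment-angle space pointwise; its inverse up to homotopy is the
  inclusion.\<close>

lemma facet_incidence_space_eqv_moment_angle_space:
  fixes a :: "'m::finite \<Rightarrow> real ^ 'n"
  shows "facet_incidence_space a b homotopy_eqv moment_angle_space a b"
proof -
  let ?L = "facet_incidence_space a b" and ?Z = "moment_angle_space a b"
  define f :: "(real ^ 'n) \<times> (complex ^ 'm) \<Rightarrow> (real ^ 'n) \<times> (complex ^ 'm)"
    where "f w = (fst w, \<chi> i. sqrt (a i \<bullet> fst w + b i) *\<^sub>R sgn (snd w $ i))" for w
  have Z_iff: "(x, z) \<in> ?Z \<longleftrightarrow>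
      x \<in> H_polyhedron a b \<and> (\<forall>i. a i \<bullet> x + b i = (cmod (z $ i))\<^sup>2)" for x z
    by (simp add: moment_angle_space_def polytope_embedding_def moment_map_def vec_eq_iff)
  have ZL: "?Z \<subseteq> ?L"
    by (auto simp: Z_iff facet_incidence_space_def)
  \<comment> \<open>The condition defining \<open>?L\<close> is exactly what continuity needs at the
    zeros of \<open>z\<close>.\<close>
  have contf: "continuous_on ?L f"
    unfolding f_def
    by (intro continuous_intros continuous_on_sgn_scaleR) (auto simp: facet_incidence_space_def)
  have fZ: "f w \<in> ?Z" if "w \<in> ?L" for w
    using that
    by (auto simp: f_def Z_iff facet_incidence_space_def H_polyhedron_def norm_sgn power_mult_distrib)
  have f_id: "f w = w" if "w \<in> ?Z" for w
  proof -
    have "cmod c *\<^sub>R sgn c = c" for c by (cases "c = 0") (auto simp: sgn_div_norm)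
    then show ?thesis
      using that by (cases w) (auto simp: f_def Z_iff vec_eq_iff)
  qed
  have segL: "closed_segment (f w) w \<subseteq> ?L" if w: "w \<in> ?L" for w
  proof
    fix y assume "y \<in> closed_segment (f w) w"
    then obtain u where u: "0 \<le> u" "u \<le> 1" and y: "y = (1 - u) *\<^sub>R f w + u *\<^sub>R w"
      by (rule in_segmentE)
    obtain x z where xz: "w = (x, z)" by fastforce
    have fst_y: "fst y = x"
      by (simp add: y xz f_def flip: scaleR_left.add)
    have "a i \<bullet> x + b i = 0" if "snd y $ i = 0" for i
    proof (rule ccontr)
      \<comment> \<open>Off facet \<open>i\<close>, the coordinate of \<open>y\<close> is this
        positive multiple of the nonzero \<open>z $ i\<close>.\<close>
      let ?c = "(1 - u) * sqrt (a i \<bullet> x + b i) * inverse (cmod (z $ i)) + u"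
      assume ne: "a i \<bullet> x + b i \<noteq> 0"
      then have "z $ i \<noteq> 0" "0 < a i \<bullet> x + b i"
        using w by (auto simp: xz facet_incidence_space_def H_polyhedron_def less_le)
      then have "0 < ?c"
        using u by (cases "u = 1") (auto intro!: add_pos_nonneg)
      moreover have "snd y $ i = ?c *\<^sub>R z $ i"
        by (simp add: y xz f_def sgn_div_norm scaleR_left.add)
      ultimately show False
        using that \<open>z $ i \<noteq> 0\<close> by simp
    qed
    then have "(fst y, snd y) \<in> ?L"
      using w by (auto simp: fst_y xz facet_incidence_space_def)
    then show "y \<in> ?L" by simp
  qed
  show ?thesis
    by (rule homotopy_eqv_linear[where f = f and g = id])
      (use ZL contf fZ f_id segL in \<open>auto simp: continuous_on_id\<close>)
qed

theorem theorem2: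
  fixes a :: "'m::finite \<Rightarrow> real ^ 'n" and b :: "'m \<Rightarrow> real"
  assumes "bounded (H_polyhedron a b)"
    and "aff_dim (H_polyhedron a b) = int CARD('n)"
    and "bij_betw (H_facet a b) UNIV {F. F facet_of H_polyhedron a b}"
  shows "moment_angle_complex (facet_complex a b) homotopy_eqv moment_angle_space a b"
proof -
  \<comment> \<open>The empty set has affine dimension -1.\<close>
  have P: "H_polyhedron a b \<noteq> {}"
    using assms(2) by auto
  note moment_angle_complex_eqv_arrangement_complement[OF abstract_simplicial_complex_facet_complex[OF P]]
  also note arrangement_complement_eqv_facet_incidence_space[OF P]
  also note facet_incidence_space_eqv_moment_angle_space
  finally show ?thesis .
qed

end
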